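(* Let $\mathcal{S}$ be a realizability structure and $n$ a positive integer. A term $\phi$ realizes $\mathrm{N}_n$ with respect to $\mathcal{S}$ if and only if $\phi$ is an $n$-voting instruction modulo $\succ_{\mathcal{S}}$.
   Context: $\lambda_c$-calculus. Fix a countably infinite set of variables. $\lambda_c$-terms: $t,u ::= x \mid tu \mid \lambda x.t \mid \mathrm{cc} \mid k_\pi$ ($\pi$ a stack) $\mid \kappa_m$ ($m\in\mathbb{N}$) $\mid \beta_m$ ($m\in\mathbb{N}$), modulo $\alpha$-equivalence. A term is a closed $\lambda_c$-term; $\Lambda$ is the set of terms. Stacks: $\pi ::= \omega_m \mid t\cdot\pi$ ($t\in\Lambda$); $\Pi$ is the set of stacks. Processes: $t\star\pi$ with $t\in\Lambda,\pi\in\Pi$. One-step evaluation $\succ_1$: $tu\star\pi \succ_1 t\star u\cdot\pi$, $\lambda x.t\star u\cdot\pi\succ_1 t[x:=u]\star\pi$, $\mathrm{cc}\star t\cdot\pi\succ_1 t\star k_\pi\cdot\pi$, $k_{\pi'}\star t\cdot\pi\succ_1 t\star\pi'$; $\succ$ is its reflexive-transitive closure. A pole is a set $\perp\!\!\!\perp$ of processes with $p\succ q$, $q\in\perp\!\!\!\perp\Rightarrow p\in\perp\!\!\!\perp$. A realizability structure is a set $\mathcal{S}$ of poles. Formulas used: $\top$, second-order nullary variables $X$, $A\to B$ (right-associative), $A\cap B$, $\forall X\,A$. For a pole: $\|\top\|=\emptyset$, $\|A\to B\|=\{t\cdot\pi:t\in|A|,\pi\in\|B\|\}$, $\|A\cap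 B\|=\|A\|\cup\|B\|$, $\|\forall X\,A\|=\bigcup_{S\subseteq\Pi}\|A[X:=S]\|$, $\|S\|=S$ for $S\subseteq\Pi$; $|A|=\{t\in\Lambda:\forall\pi\in\|A\|,\ t\star\pi\in\perp\!\!\!\perp\}$; $t$ realizes $A$ w.r.t. $\perp\!\!\!\perp$ if $t\in|A|$, and w.r.t. $\mathcal{S}$ if it does so for every $\perp\!\!\!\perp\in\mathcal{S}$. $\mathrm{N}_n$ is the formula $\forall X\,(B_1\cap\cdots\cap B_n)$ where $B_i$ is $C_{i,1}\to\cdots\to C_{i,n}\to X$ with $C_{i,i}=\top$ and $C_{i,k}=X$ for $k\ne i$. For a realizability structure $\mathcal{S}$, $\succ_{\mathcal{S}}$ is the binary relation on sets of processes defined by: $P\succ_{\mathcal{S}}Q$ iff for every $\perp\!\!\!\perp\in\mathcal{S}$, $Q\subseteq\perp\!\!\!\perp$ implies $P\cap\perp\!\!\!\perp\neq\emptyset$. An $n$-voting instruction modulo a relation $\succ'$ on sets of processes is a term $\phi$ such that for all terms $t_1,\dots,t_n$, all stacks $\pi$ and all $j\in\{1,\dots,n\}$, $\{\phi\star t_1\cdot\ldots\cdot t_n\cdot\pi\}\succ'\{t_i\star\pi: i\neq j\}$. *)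

theory Defs
  imports Main
begin

(* Lambda_c-terms modulo alpha-equivalence, in de Bruijn notation. The raw datatype also
   allows pushing an open term on a stack; closed_at and is_stack rule this out. *)
datatype trm =
    Var nat
  | App trm trm
  | Lam trm
  | CC
  | Kont stack
  | Kappa nat
  | Beta nat
and stack =
    Omega nat
  | Push trm stack  (infixr "\<cdot>" 65)

(* closed_at t k: t is a lambda_c-term whose free de Bruijn indices are all below k. *)
primrec closed_at :: "trm \<Rightarrow> nat \<Rightarrow> bool"
  and is_stack :: "stack \<Rightarrow> bool" where
  "closed_at (Var i) k \<longleftrightarrow> i < k"
| "closed_at (App t u) k \<longleftrightarrow> closed_at t k \<and> closed_at u k"
| "closed_at (Lam t) k \<longleftrightarrow> closed_at t (Suc k)"
| "closed_at CC k \<longleftrightarrow> True"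
| "closed_at (Kont \<pi>) k \<longleftrightarrow> is_stack \<pi>"
| "closed_at (Kappa m) k \<longleftrightarrow> True"
| "closed_at (Beta m) k \<longleftrightarrow> True"
| "is_stack (Omega m) \<longleftrightarrow> True"
| "is_stack (t \<cdot> \<pi>) \<longleftrightarrow> closed_at t 0 \<and> is_stack \<pi>"

definition Terms :: "trm set" where
  "Terms = {t. closed_at t 0}"

definition Stacks :: "stack set" where
  "Stacks = {\<pi>. is_stack \<pi>}"

type_synonym process = "trm \<times> stack"

definition Processes :: "process set" where
  "Processes = Terms \<times> Stacks"

(* Stacks contain closed terms only, so lifting and substitution leave continuations alone. *)
primrec lift :: "trm \<Rightarrow> nat \<Rightarrow> trm" where
  "lift (Var i) k = (if i < k then Var i else Var (Suc i))"
| "lift (App t u) k = App (lift t k) (lift u k)"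
| "lift (Lam t) k = Lam (lift t (Suc k))"
| "lift CC k = CC"
| "lift (Kont \<pi>) k = Kont \<pi>"
| "lift (Kappa m) k = Kappa m"
| "lift (Beta m) k = Beta m"

primrec subst :: "trm \<Rightarrow> trm \<Rightarrow> nat \<Rightarrow> trm" where
  "subst (Var i) u k = (if k < i then Var (i - 1) else if i = k then u else Var i)"
| "subst (App s t) u k = App (subst s u k) (subst t u k)"
| "subst (Lam t) u k = Lam (subst t (lift u 0) (Suc k))"
| "subst CC u k = CC"
| "subst (Kont \<pi>) u k = Kont \<pi>"
| "subst (Kappa m) u k = Kappa m"
| "subst (Beta m) u k = Beta m"

inductive eval1 :: "process \<Rightarrow> process \<Rightarrow> bool"  (infix "\<succ>\<^sub>1" 50) where
  push: "\<lbrakk>t \<in> Terms; u \<in> Terms; \<pi> \<in> Stacks\<rbrakk> \<Longrightarrow> (App t u, \<pi>) \<succ>\<^sub>1 (t, u \<cdot> \<pi>)"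
| grab: "\<lbrakk>Lam t \<in> Terms; u \<in> Terms; \<pi> \<in> Stacks\<rbrakk> \<Longrightarrow> (Lam t, u \<cdot> \<pi>) \<succ>\<^sub>1 (subst t u 0, \<pi>)"
| save: "\<lbrakk>t \<in> Terms; \<pi> \<in> Stacks\<rbrakk> \<Longrightarrow> (CC, t \<cdot> \<pi>) \<succ>\<^sub>1 (t, Kont \<pi> \<cdot> \<pi>)"
| restore: "\<lbrakk>t \<in> Terms; \<pi> \<in> Stacks; \<pi>' \<in> Stacks\<rbrakk> \<Longrightarrow> (Kont \<pi>', t \<cdot> \<pi>) \<succ>\<^sub>1 (t, \<pi>')"

abbreviation eval :: "process \<Rightarrow> process \<Rightarrow> bool"  (infix "\<succ>" 50) where
  "p \<succ> q \<equiv> eval1\<^sup>*\<^sup>* p q"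

definition is_pole :: "process set \<Rightarrow> bool" where
  "is_pole P \<longleftrightarrow> P \<subseteq> Processes \<and> (\<forall>p q. p \<succ> q \<longrightarrow> q \<in> P \<longrightarrow> p \<in> P)"

definition realizability_structure :: "process set set \<Rightarrow> bool" where
  "realizability_structure S \<longleftrightarrow> (\<forall>P\<in>S. is_pole P)"

(* Formulas with parameters: Par S is the set of stacks S used as a formula. *)
datatype form =
    Top
  | PVar nat
  | Par "stack set"
  | Imp form form  (infixr "\<rightarrow>\<^sub>f" 25)
  | Inter form form  (infixr "\<inter>\<^sub>f" 30)
  | All nat form

primrec fsubst :: "form \<Rightarrow> nat \<Rightarrow> stack set \<Rightarrow> form" where
  "fsubst Top X S = Top"
| "fsubst (PVar Y) X S = (if Y = X then Par S else PVar Y)"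
| "fsubst (Par T) X S = Par T"
| "fsubst (A \<rightarrow>\<^sub>f B) X S = (fsubst A X S \<rightarrow>\<^sub>f fsubst B X S)"
| "fsubst (A \<inter>\<^sub>f B) X S = (fsubst A X S \<inter>\<^sub>f fsubst B X S)"
| "fsubst (All Y A) X S = All Y (if Y = X then A else fsubst A X S)"

lemma size_fsubst [simp]: "size (fsubst A X S) = size A"
  by (induction A) auto

definition orth :: "process set \<Rightarrow> stack set \<Rightarrow> trm set" where
  "orth P F = {t \<in> Terms. \<forall>\<pi>\<in>F. (t, \<pi>) \<in> P}"

(* Only closed formulas have a meaning: the value given to a free variable is arbitrary. *)
function falsity :: "process set \<Rightarrow> form \<Rightarrow> stack set" where
  "falsity P Top = {}"
| "falsity P (PVar X) = {}"
| "falsity P (Par S) = S"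
| "falsity P (A \<rightarrow>\<^sub>f B) = {t \<cdot> \<pi> | t \<pi>. t \<in> orth P (falsity P A) \<and> \<pi> \<in> falsity P B}"
| "falsity P (A \<inter>\<^sub>f B) = falsity P A \<union> falsity P B"
| "falsity P (All X A) = (\<Union>S\<in>Pow Stacks. falsity P (fsubst A X S))"
  by pat_completeness auto
termination
  by (relation "measure (\<lambda>(P, A). size A)") auto

definition truth :: "process set \<Rightarrow> form \<Rightarrow> trm set" where
  "truth P A = orth P (falsity P A)"

definition realizes :: "process set set \<Rightarrow> trm \<Rightarrow> form \<Rightarrow> bool" where
  "realizes S t A \<longleftrightarrow> (\<forall>P\<in>S. t \<in> truth P A)"

(* The case of the empty list is not used. *)
fun inters :: "form list \<Rightarrow> form" where
  "inters [] = Top"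
| "inters [A] = A"
| "inters (A # B # As) = (A \<inter>\<^sub>f inters (B # As))"

definition N_body :: "nat \<Rightarrow> nat \<Rightarrow> form" where
  "N_body n i = foldr Imp (map (\<lambda>k. if k = i then Top else PVar 0) [1..<Suc n]) (PVar 0)"

definition N_form :: "nat \<Rightarrow> form" where
  "N_form n = All 0 (inters (map (N_body n) [1..<Suc n]))"

definition succ_struct :: "process set set \<Rightarrow> process set \<Rightarrow> process set \<Rightarrow> bool" where
  "succ_struct S P Q \<longleftrightarrow> (\<forall>B\<in>S. Q \<subseteq> B \<longrightarrow> P \<inter> B \<noteq> {})"

definition voting_instruction ::
  "nat \<Rightarrow> (process set \<Rightarrow> process set \<Rightarrow> bool) \<Rightarrow> trm \<Rightarrow> bool" where
  "voting_instruction n R \<phi> \<longleftrightarrow> \<phi> \<in> Terms \<and>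
     (\<forall>t :: nat \<Rightarrow> trm. \<forall>\<pi>\<in>Stacks. \<forall>j\<in>{1..n}. (\<forall>i\<in>{1..n}. t i \<in> Terms) \<longrightarrow>
        R {(\<phi>, foldr Push (map t [1..<Suc n]) \<pi>)} {(t i, \<pi>) | i. i \<in> {1..n} \<and> i \<noteq> j})"

end

theory Submission
  imports Defs
begin

text \<open>Fix a pole and argue pointwise. If \<open>\<phi>\<close> realizes \<open>N\<^sub>n\<close>, instantiate \<open>X\<close> by \<open>{\<pi>}\<close>: then
  \<open>t\<close> realizes \<open>X\<close> exactly when \<open>(t, \<pi>)\<close> lies in the pole. Conversely, for an arbitrary value of
  \<open>X\<close> containing \<open>\<pi>\<close>, every realizer \<open>t\<close> of \<open>X\<close> has \<open>(t, \<pi>)\<close> in the pole, so the voting condition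
  applies.\<close>

lemma fsubst_foldr_Imp:
  "fsubst (foldr Imp As B) X S = foldr Imp (map (\<lambda>A. fsubst A X S) As) (fsubst B X S)"
  by (induction As) auto

lemma fsubst_inters: "fsubst (inters As) X S = inters (map (\<lambda>A. fsubst A X S) As)"
  by (induction As rule: inters.induct) auto

text \<open>The empty list fits too: \<open>inters []\<close> is \<open>Top\<close>, whose falsity
  value is the empty union.\<close>

lemma falsity_inters: "falsity P (inters As) = (\<Union>A\<in>set As. falsity P A)"
  by (induction As rule: inters.induct) auto

text \<open>Packing the arguments into one function on indices gives the shape used in
  \<open>voting_instruction\<close>. Distinctness of the indices lets such a function take
  independent realizers at different positions.\<close>

lemma falsity_foldr_Imp:
  assumes "distinct xs"
  shows "falsity P (foldr Imp (map A xs) B) =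
    {foldr Push (map t xs) \<pi> | t \<pi>. (\<forall>k\<in>set xs. t k \<in> truth P (A k)) \<and> \<pi> \<in> falsity P B}"
  using assms
proof (induction xs)
  case (Cons x xs)
  show ?case
  proof (intro equalityI subsetI)
    fix \<rho> assume "\<rho> \<in> falsity P (foldr Imp (map A (x # xs)) B)"
    then obtain u t \<pi> where u: "u \<in> truth P (A x)"
      and t: "\<forall>k\<in>set xs. t k \<in> truth P (A k)" and \<pi>: "\<pi> \<in> falsity P B"
      and \<rho>: "\<rho> = u \<cdot> foldr Push (map t xs) \<pi>"
      using Cons by (auto simp: truth_def)
    \<comment> \<open>Since \<open>x\<close> does not occur in \<open>xs\<close>, the update
      supplies the new head and leaves the tail unchanged.\<close>
    have "\<rho> = foldr Push (map (t(x := u)) (x # xs)) \<pi>"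
      using Cons.prems \<rho> by simp
    then show "\<rho> \<in> {foldr Push (map t (x # xs)) \<pi> | t \<pi>.
        (\<forall>k\<in>set (x # xs). t k \<in> truth P (A k)) \<and> \<pi> \<in> falsity P B}"
      using u t \<pi> by (intro CollectI exI[of _ "t(x := u)"] exI[of _ \<pi>]) auto
  next
    fix \<rho> assume "\<rho> \<in> {foldr Push (map t (x # xs)) \<pi> | t \<pi>.
        (\<forall>k\<in>set (x # xs). t k \<in> truth P (A k)) \<and> \<pi> \<in> falsity P B}"
    then show "\<rho> \<in> falsity P (foldr Imp (map A (x # xs)) B)"
      using Cons by (auto simp: truth_def)
  qed
qed auto

lemma fsubst_N_body:
  "fsubst (N_body n i) 0 S =
    foldr Imp (map (\<lambda>k. if k = i then Top else Par S) [1..<Suc n]) (Par S)"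
  by (simp add: N_body_def fsubst_foldr_Imp comp_def if_distrib[of "\<lambda>A. fsubst A _ _"]
      del: upt_Suc cong: if_cong)

lemma truth_Top: "truth P Top = Terms"
  by (simp add: truth_def orth_def)

lemma truth_Par: "truth P (Par S) = orth P S"
  by (simp add: truth_def)

lemma falsity_N_body:
  "falsity P (fsubst (N_body n i) 0 S) =
    {foldr Push (map t [1..<Suc n]) \<pi> | t \<pi>.
      (\<forall>k\<in>{1..n}. t k \<in> (if k = i then Terms else orth P S)) \<and> \<pi> \<in> S}"
  unfolding fsubst_N_body
  by (simp add: falsity_foldr_Imp if_distrib[of "truth P"] truth_Top truth_Par
      atLeastLessThanSuc_atLeastAtMost del: upt_Suc cong: if_cong)

text \<open>The theorem for a single pole: the component of the intersection with \<open>Top\<close>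
  in position \<open>j\<close> corresponds to the vote \<open>j\<close> that is ignored.\<close>

lemma truth_N_form_iff:
  assumes "\<phi> \<in> Terms"
  shows "\<phi> \<in> truth P (N_form n) \<longleftrightarrow>
    (\<forall>t. \<forall>\<pi>\<in>Stacks. \<forall>j\<in>{1..n}. (\<forall>i\<in>{1..n}. t i \<in> Terms) \<longrightarrow>
      {(t i, \<pi>) | i. i \<in> {1..n} \<and> i \<noteq> j} \<subseteq> P \<longrightarrow>
      (\<phi>, foldr Push (map t [1..<Suc n]) \<pi>) \<in> P)" (is "_ \<longleftrightarrow> ?V")
proof -
  have falsity: "falsity P (N_form n) =
      (\<Union>S\<in>Pow Stacks. \<Union>j\<in>{1..n}. falsity P (fsubst (N_body n j) 0 S))"
    by (simp add: N_form_def fsubst_inters falsity_inters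
        atLeastLessThanSuc_atLeastAtMost del: upt_Suc)
  show ?thesis
  proof
    assume \<phi>: "\<phi> \<in> truth P (N_form n)"
    show ?V
    proof (intro allI ballI impI)
      fix t :: "nat \<Rightarrow> trm" and \<pi> j
      assume \<pi>: "\<pi> \<in> Stacks" and j: "j \<in> {1..n}" and t: "\<forall>i\<in>{1..n}. t i \<in> Terms"
        and sub: "{(t i, \<pi>) | i. i \<in> {1..n} \<and> i \<noteq> j} \<subseteq> P"
      \<comment> \<open>About position \<open>j\<close>, \<open>sub\<close> says nothing, but there
        \<open>Top\<close> only asks for a closed term.\<close>
      have "\<forall>k\<in>{1..n}. t k \<in> (if k = j then Terms else orth P {\<pi>})"
      proof
        fix k assume k: "k \<in> {1..n}"
        show "t k \<in> (if k = j then Terms else orth P {\<pi>})"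
        proof (cases "k = j")
          case False
          then have "(t k, \<pi>) \<in> P"
            using k by (intro subsetD[OF sub]) blast
          then show ?thesis
            using t k False by (simp add: orth_def)
        qed (use t k in simp)
      qed
      then have "foldr Push (map t [1..<Suc n]) \<pi> \<in> falsity P (fsubst (N_body n j) 0 {\<pi>})"
        unfolding falsity_N_body by (intro CollectI exI[of _ t] exI[of _ \<pi>]) simp
      then have "foldr Push (map t [1..<Suc n]) \<pi> \<in> falsity P (N_form n)"
        unfolding falsity using \<pi> j by blast
      then show "(\<phi>, foldr Push (map t [1..<Suc n]) \<pi>) \<in> P"
        using \<phi> unfolding truth_def orth_def by blast
    qed
  next
    assume V: ?V
    have "(\<phi>, \<rho>) \<in> P" if \<rho>: "\<rho> \<in> falsity P (N_form n)" for \<rho>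
    proof -
      obtain S j t \<pi> where S: "S \<subseteq> Stacks" and j: "j \<in> {1..n}"
        and t: "\<forall>k\<in>{1..n}. t k \<in> (if k = j then Terms else orth P S)"
        and \<pi>: "\<pi> \<in> S" and eq: "\<rho> = foldr Push (map t [1..<Suc n]) \<pi>"
        using \<rho> unfolding falsity falsity_N_body by blast
      \<comment> \<open>Both branches of the conditional yield closed terms, because
        \<open>orth\<close> is cut out of \<open>Terms\<close>.\<close>
      have "\<forall>i\<in>{1..n}. t i \<in> Terms"
        using t by (auto simp: orth_def split: if_splits)
      moreover have "(t i, \<pi>) \<in> P" if "i \<in> {1..n}" "i \<noteq> j" for i
        using bspec[OF t that(1)] that(2) \<pi> by (simp add: orth_def)
      then have "{(t i, \<pi>) | i. i \<in> {1..n} \<and> i \<noteq> j} \<subseteq> P"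
        by blast
      ultimately show ?thesis
        using V[rule_format, of \<pi> j t] subsetD[OF S \<pi>] j unfolding eq by blast
    qed
    then show "\<phi> \<in> truth P (N_form n)"
      using assms by (simp add: truth_def orth_def)
  qed
qed

theorem mainTheorem4:
  fixes S :: "process set set" and n :: nat and \<phi> :: trm
  assumes "realizability_structure S"
    and "n > 0"
    and "\<phi> \<in> Terms"
  shows "realizes S \<phi> (N_form n) \<longleftrightarrow> voting_instruction n (succ_struct S) \<phi>"
proof -
  \<comment> \<open>The left side of the voting relation is a singleton, so meeting a pole means
    membership in it.\<close>
  have single: "{p} \<inter> B \<noteq> {} \<longleftrightarrow> p \<in> B" for p :: process and B
    by simp
  show ?thesis
    unfolding realizes_def voting_instruction_def succ_struct_def single
      truth_N_form_iff[OF assms(3)]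
    \<comment> \<open>The two sides now differ only in whether the pole is quantified before or
      after the votes.\<close>
    using assms(3) by meson
qed

end
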